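(* There exist a function $f \colon [0,1] \to \mathbb{R}$ that admits derivatives of all orders and a Lebesgue measurable set $E \subseteq [0,1]$ such that $|E|>0$ and $f$ cuts the real axis at every $x \in E$.
   Context: Here $|E|$ denotes the Lebesgue measure of $E$. A function $f \colon [0,1] \to \mathbb{R}$ cuts the real axis at a point $x \in [0,1]$ provided that $f(x)=0$ and for every $\delta>0$ there exist $x_1, x_2 \in [0,1]$ such that $|x-x_i|<\delta$ for $i=1,2$ and $f(x_1)<0<f(x_2)$. *)

theory Defs
  imports "HOL-Analysis.Analysis"
begin

text \<open>
  Derivatives are taken relative to S, so they are one-sided at the endpoints of an
  interval and values outside S play no role. The witness D lists the successive
  derivatives; if S is an interval of positive length, D is unique on S.
\<close>
definition has_derivatives_of_all_orders_on :: "(real \<Rightarrow> real) \<Rightarrow> real set \<Rightarrow> bool" where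
  "has_derivatives_of_all_orders_on f S \<longleftrightarrow>
     (\<exists>D :: nat \<Rightarrow> real \<Rightarrow> real.
        (\<forall>x\<in>S. D 0 x = f x) \<and>
        (\<forall>n. \<forall>x\<in>S. (D n has_real_derivative D (Suc n) x) (at x within S)))"

text \<open>
  A function on [0,1] is represented by a total function whose values outside [0,1]
  are never inspected.
\<close>
definition cuts_real_axis_at :: "(real \<Rightarrow> real) \<Rightarrow> real \<Rightarrow> bool" where
  "cuts_real_axis_at f x \<longleftrightarrow>
     x \<in> {0..1} \<and> f x = 0 \<and>
     (\<forall>\<delta>>0. \<exists>x1\<in>{0..1}. \<exists>x2\<in>{0..1}.
        \<bar>x - x1\<bar> < \<delta> \<and> \<bar>x - x2\<bar> < \<delta> \<and> f x1 < 0 \<and> 0 < f x2)"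

end

theory Submission
  imports Defs "HOL-Computational_Algebra.Polynomial"
begin

text \<open>
  The set where the function cuts the axis is what remains of the open unit interval after
  removing small disjoint closed intervals that accumulate at every remaining point, and the
  function changes sign inside each removed interval.

  The intervals are centred at rationals and chosen greedily: the \<open>n\<close>-th rational is the centre of
  a new interval unless an earlier interval contains it already
  (\<open>disjoint_cballs_absorbing_sequence\<close>). Their radii are so small that their total length is at
  most one half, so the remaining set has positive measure. Every rational lies in an interval of the
  family and the radii tend to zero, so every neighbourhood of a point outside all the intervals
  contains an entire interval (\<open>small_ball_near_uncovered_point\<close>).

  On the \<open>n\<close>-th interval, with centre \<open>q\<close> and radius \<open>r\<close>, the function is a small multiple of
  \<open>b ((x - q) / r)\<close>, where \<open>b x = x * exp (- 1 / (1 - x\<^sup>2))\<close> on the open interval from \<open>- 1\<close> to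
  \<open>1\<close> and \<open>b x = 0\<close> elsewhere. This \<open>b\<close> is smooth with bounded derivatives, negative to the left of
  \<open>0\<close> and positive to the right (\<open>odd_bump_exists\<close>). The \<open>k\<close>-th derivative of a rescaled bump
  grows like \<open>(1 / r) ^ k\<close>; the multiple \<open>(1/2) ^ n * exp (- 1 / r)\<close> beats this for all \<open>k\<close>
  at once, so the series may be differentiated term by term any number of times
  (\<open>rescaled_series_has_derivatives_of_all_orders\<close>). Since the intervals are disjoint, no other
  term of the series disturbs the signs inside an interval.
\<close>

section \<open>A smooth bump that changes sign\<close>

text \<open>
  The polynomial factor and the power of \<open>inverse (1 - x\<^sup>2)\<close> make this family closed under
  differentiation, so that all derivatives of the bump can be controlled by statements about one
  member of the family.
\<close>
definition flat_bump :: "real poly \<Rightarrow> nat \<Rightarrow> real \<Rightarrow> real" where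
  "flat_bump p m x =
     (if \<bar>x\<bar> < 1 then poly p x * inverse (1 - x^2) ^ m * exp (- inverse (1 - x^2)) else 0)"

text \<open>
  The number \<open>u ^ k / fact k\<close> is one of the nonnegative terms of the exponential series of \<open>u\<close>.
  With \<open>u\<close> the reciprocal of a distance, this is the flatness of \<open>exp (- inverse s)\<close> at \<open>s = 0\<close>.
\<close>
lemma power_times_exp_minus_le_fact:
  fixes u :: real
  assumes "0 \<le> u"
  shows "u ^ k * exp (- u) \<le> fact k"
proof -
  have "u ^ k / fact k \<le> exp u"
  proof -
    have s: "(\<lambda>n. u ^ n /\<^sub>R fact n) sums exp u"
      by (rule exp_converges)
    have "(\<Sum>n\<in>{k}. u ^ n /\<^sub>R fact n) \<le> (\<Sum>n. u ^ n /\<^sub>R fact n)"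
      by (rule sum_le_suminf) (use s assms in \<open>auto simp: sums_iff\<close>)
    then show ?thesis
      using s by (simp add: sums_iff divide_inverse mult.commute)
  qed
  then show ?thesis
    by (simp add: exp_minus field_simps)
qed

text \<open>
  The exponential absorbs two more powers of \<open>inverse (1 - x\<^sup>2)\<close> than are present, which leaves
  a factor \<open>(1 - x\<^sup>2)\<^sup>2\<close>. Its square root is at most twice the distance from \<open>x\<close> to any point
  \<open>x0\<close> outside the open unit ball, and so the bump vanishes to second order at all such points.
\<close>
lemma flat_bump_bound:
  "\<exists>K. (\<forall>x. \<bar>flat_bump p m x\<bar> \<le> K) \<and>
       (\<forall>x x0. 1 \<le> \<bar>x0\<bar> \<longrightarrow> \<bar>flat_bump p m x\<bar> \<le> K * (x - x0)^2)"
proof -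
  have "bounded (poly p ` {-1..1})"
    by (intro compact_imp_bounded compact_continuous_image continuous_intros) auto
  then obtain C where C: "\<And>x. x \<in> {-1..1} \<Longrightarrow> \<bar>poly p x\<bar> \<le> C"
    by (fastforce simp: bounded_iff)
  have C0: "0 \<le> C" using C[of 0] by auto
  define K where "K = C * fact (m + 2)"
  have K0: "0 \<le> K" using C0 by (simp add: K_def)
  have main: "\<bar>flat_bump p m x\<bar> \<le> K * (1 - x^2)^2" if "\<bar>x\<bar> < 1" for x
  proof -
    define s where "s = 1 - x^2"
    have s: "0 < s" using that by (simp add: s_def abs_square_less_1)
    have "\<bar>flat_bump p m x\<bar> = \<bar>poly p x\<bar> * (inverse s ^ m * exp (- inverse s))"
      using that s by (simp add: flat_bump_def abs_mult s_def[symmetric])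
    also have "inverse s ^ m * exp (- inverse s) = inverse s ^ (m + 2) * exp (- inverse s) * s^2"
    proof -
      have "(inverse s)^2 * s^2 = 1"
        using s by (simp flip: power_mult_distrib)
      moreover have "inverse s ^ (m + 2) * exp (- inverse s) * s^2
          = inverse s ^ m * exp (- inverse s) * ((inverse s)^2 * s^2)"
        unfolding power_add by (simp only: mult_ac)
      ultimately show ?thesis by simp
    qed
    also have "\<bar>poly p x\<bar> * \<dots> \<le> C * (fact (m + 2) * s^2)"
      using that s C0
      by (intro mult_mono C power_times_exp_minus_le_fact) auto
    finally show ?thesis by (simp add: K_def s_def)
  qed
  show ?thesis
  proof (intro exI[of _ "4 * K"] conjI allI impI)
    show "\<bar>flat_bump p m x\<bar> \<le> 4 * K" for x
    proof (cases "\<bar>x\<bar> < 1")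
      case True
      then have "(1 - x^2)^2 \<le> 1"
        by (intro power_le_one) (auto simp: abs_square_less_1 less_imp_le)
      then have "K * (1 - x^2)^2 \<le> K * 1" using K0 by (rule mult_left_mono)
      then show ?thesis using main[OF True] K0 by linarith
    qed (use K0 in \<open>simp add: flat_bump_def\<close>)
    show "\<bar>flat_bump p m x\<bar> \<le> 4 * K * (x - x0)^2" if x0: "1 \<le> \<bar>x0\<bar>" for x x0
    proof (cases "\<bar>x\<bar> < 1")
      case True
      have "1 - x^2 = (1 - \<bar>x\<bar>) * (1 + \<bar>x\<bar>)"
        by (simp add: algebra_simps power2_eq_square)
      also have "\<dots> \<le> \<bar>x - x0\<bar> * 2"
        using True x0 by (intro mult_mono) auto
      finally have "(1 - x^2)^2 \<le> (\<bar>x - x0\<bar> * 2)^2"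
        using True by (intro power_mono) (auto simp: abs_square_less_1 less_imp_le)
      also have "\<dots> = 4 * (x - x0)^2" by (simp add: power_mult_distrib)
      finally have "K * (1 - x^2)^2 \<le> K * (4 * (x - x0)^2)"
        using K0 by (rule mult_left_mono)
      then show ?thesis using main[OF True] by simp
    qed (use K0 in \<open>simp add: flat_bump_def\<close>)
  qed
qed

lemma has_real_derivative_zero_if_quadratic:
  fixes f :: "real \<Rightarrow> real"
  assumes "\<And>x. \<bar>f x\<bar> \<le> K * (x - x0)^2"
  shows "(f has_real_derivative 0) (at x0)"
proof -
  have f0: "f x0 = 0" using assms[of x0] by simp
  have "((\<lambda>x. (f x - f x0) / (x - x0)) \<longlongrightarrow> 0) (at x0)"
  proof (rule Lim_null_comparison)
    show "eventually (\<lambda>x. norm ((f x - f x0) / (x - x0)) \<le> K * \<bar>x - x0\<bar>) (at x0)"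
    proof (intro eventually_at_filter[THEN iffD2] always_eventually allI impI)
      fix x assume "x \<noteq> x0"
      then show "norm ((f x - f x0) / (x - x0)) \<le> K * \<bar>x - x0\<bar>"
        using assms[of x]
        by (simp add: f0 divide_le_eq mult.assoc power2_eq_square flip: abs_mult)
    qed
    show "((\<lambda>x. K * \<bar>x - x0\<bar>) \<longlongrightarrow> 0) (at x0)"
      by (rule tendsto_eq_intros refl | simp)+
  qed
  then show ?thesis by (simp add: has_field_derivative_iff)
qed

text \<open>
  Inside the unit ball this is the product rule, which raises the exponent \<open>m\<close> by two. Outside, and
  also at the two gluing points, the quadratic bound makes the derivative zero.
\<close>
lemma flat_bump_has_derivative:
  "\<exists>q l. \<forall>x. (flat_bump p m has_real_derivative flat_bump q l x) (at x)"
proof -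
  define q where "q = pderiv p * [:1, 0, -1:]^2 + [:0, 2 * of_nat m:] * p * [:1, 0, -1:] - [:0, 2:] * p"
  have "(flat_bump p m has_real_derivative flat_bump q (m + 2) x) (at x)" for x
  proof (cases "\<bar>x\<bar> < 1")
    case True
    define s where "s = 1 - x^2"
    have s: "s > 0" using True by (simp add: s_def abs_square_less_1)
    have qx: "poly q x = poly (pderiv p) x * s^2 + 2 * m * x * poly p x * s - 2 * x * poly p x"
      by (simp add: q_def s_def algebra_simps power2_eq_square)
    define i where "i = inverse s"
    have si: "s * i = 1" using s by (simp add: i_def)
    \<comment> \<open>The factor \<open>real m\<close> covers \<open>m = 0\<close>, where the exponent \<open>m - 1\<close> is truncated.\<close>
    have m: "real m * i ^ (m - 1) = real m * i ^ m * s"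
      using si by (cases m) (auto simp: mult_ac)
    have inv: "((\<lambda>x. inverse (1 - x^2)) has_real_derivative 2 * x * i^2) (at x)"
      by (rule derivative_eq_intros refl | use s in \<open>simp add: i_def s_def power2_eq_square\<close>)+
    have pow: "((\<lambda>x. inverse (1 - x^2) ^ m) has_real_derivative real m * i ^ (m - 1) * (2 * x * i^2)) (at x)"
      using DERIV_power[OF inv, of m] by (simp add: i_def s_def mult_ac)
    have ex: "((\<lambda>x. exp (- inverse (1 - x^2))) has_real_derivative exp (- i) * (- (2 * x * i^2))) (at x)"
      using DERIV_chain2[OF DERIV_exp DERIV_minus[OF inv]] by (simp add: i_def s_def)
    have "((\<lambda>x. poly p x * inverse (1 - x^2) ^ m * exp (- inverse (1 - x^2)))
        has_real_derivative
          (poly (pderiv p) x * i ^ m + real m * i ^ (m - 1) * (2 * x * i^2) * poly p x) * exp (- i)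
          + exp (- i) * (- (2 * x * i^2)) * (poly p x * i ^ m)) (at x)"
      using DERIV_mult[OF DERIV_mult[OF poly_DERIV[of p x] pow] ex] by (simp add: i_def s_def)
    also have "(poly (pderiv p) x * i ^ m + real m * i ^ (m - 1) * (2 * x * i^2) * poly p x) * exp (- i)
          + exp (- i) * (- (2 * x * i^2)) * (poly p x * i ^ m)
        = (poly (pderiv p) x * (s * i)^2 + 2 * m * x * poly p x * s * i^2 - 2 * x * poly p x * i^2)
          * i ^ m * exp (- i)"
      unfolding m si by (simp add: algebra_simps)
    also have "\<dots> = flat_bump q (m + 2) x"
    proof -
      have "flat_bump q (m + 2) x = poly q x * i ^ (m + 2) * exp (- i)"
        using True by (simp add: flat_bump_def s_def i_def)
      then show ?thesis
        unfolding qx by (simp add: algebra_simps power_add power2_eq_square)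
    qed
    finally have "((\<lambda>x. poly p x * inverse (1 - x^2) ^ m * exp (- inverse (1 - x^2)))
        has_real_derivative flat_bump q (m + 2) x) (at x)" .
    then show ?thesis
    proof (rule has_field_derivative_transform_within_open)
      show "open {-1<..<1::real}" by simp
      show "x \<in> {-1<..<1}" using True by auto
      show "poly p y * inverse (1 - y^2) ^ m * exp (- inverse (1 - y^2)) = flat_bump p m y"
        if "y \<in> {-1<..<1}" for y
      proof -
        have "\<bar>y\<bar> < 1" using that by auto
        then show ?thesis by (simp only: flat_bump_def if_True)
      qed
    qed
  next
    case False
    obtain K where "\<forall>x x0. 1 \<le> \<bar>x0\<bar> \<longrightarrow> \<bar>flat_bump p m x\<bar> \<le> K * (x - x0)^2"
      using flat_bump_bound[of p m] by blast
    then have "(flat_bump p m has_real_derivative 0) (at x)"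
      using False by (intro has_real_derivative_zero_if_quadratic[of _ K]) auto
    then show ?thesis using False by (simp add: flat_bump_def)
  qed
  then show ?thesis by blast
qed

text \<open>
  Iterating the previous lemma from \<open>x * exp (- 1 / (1 - x\<^sup>2))\<close> yields the sequence \<open>B\<close> of
  successive derivatives.
\<close>
lemma odd_bump_exists:
  obtains B :: "nat \<Rightarrow> real \<Rightarrow> real"
  where "\<And>k x. (B k has_real_derivative B (Suc k) x) (at x)"
    and "\<And>k. \<exists>K. \<forall>x. \<bar>B k x\<bar> \<le> K"
    and "\<And>x. 1 \<le> \<bar>x\<bar> \<Longrightarrow> B 0 x = 0" "B 0 0 = 0"
    and "B 0 (1/2) > 0" "B 0 (-1/2) < 0"
proof -
  let ?x = "[:0, 1:] :: real poly"
  define P where "P k g \<longleftrightarrow> (\<exists>p m. g = flat_bump p m) \<and> (k = 0 \<longrightarrow> g = flat_bump ?x 0)"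
    for k :: nat and g
  have "\<exists>B. \<forall>k. P k (B k) \<and> (\<forall>x. (B k has_real_derivative B (Suc k) x) (at x))"
  proof (rule dependent_nat_choice)
    show "\<exists>g. P 0 g" unfolding P_def by blast
    show "\<exists>h. P (Suc k) h \<and> (\<forall>x. (g has_real_derivative h x) (at x))" if g: "P k g" for k g
    proof -
      obtain p m where "g = flat_bump p m" using g by (auto simp: P_def)
      then show ?thesis using flat_bump_has_derivative[of p m] by (auto simp: P_def)
    qed
  qed
  then obtain B where B: "\<And>k. \<exists>p m. B k = flat_bump p m" "B 0 = flat_bump ?x 0"
    "\<And>k x. (B k has_real_derivative B (Suc k) x) (at x)"
    by (auto simp: P_def)
  show ?thesis
  proof (rule that[of B])
    show "\<exists>K. \<forall>x. \<bar>B k x\<bar> \<le> K" for k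
    proof -
      obtain p m where "B k = flat_bump p m" using B(1) by blast
      then show ?thesis using flat_bump_bound[of p m] by auto
    qed
    show "(B k has_real_derivative B (Suc k) x) (at x)" for k x by (rule B(3))
  qed (simp_all add: B(2) flat_bump_def)
qed

section \<open>Smooth series of rescaled bumps\<close>

text \<open>
  Here a positive \<open>u n\<close> is the reciprocal of the width of the \<open>n\<close>-th bump, and \<open>u n = 0\<close> gives a
  constant term. Differentiating \<open>k\<close> times
  produces the factor \<open>u n ^ k\<close>, and \<open>u n ^ k * exp (- u n)\<close> is at most \<open>fact k\<close> no matter how large
  \<open>u n\<close> is. The \<open>k\<close>-th derivatives are thus dominated by a geometric series, whatever the speed
  at which the widths shrink.
\<close>
lemma rescaled_series_has_derivatives_of_all_orders:
  fixes B :: "nat \<Rightarrow> real \<Rightarrow> real" and u q :: "nat \<Rightarrow> real"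
  assumes deriv: "\<And>k x. (B k has_real_derivative B (Suc k) x) (at x)"
    and bound: "\<And>k. \<exists>K. \<forall>x. \<bar>B k x\<bar> \<le> K"
    and u: "\<And>n. 0 \<le> u n"
  shows "has_derivatives_of_all_orders_on
           (\<lambda>x. \<Sum>n. (1/2)^n * exp (- u n) * B 0 (u n * (x - q n))) S"
proof -
  define t where "t k n x = (1/2)^n * (u n ^ k * exp (- u n)) * B k (u n * (x - q n))" for k n x
  have t_bound: "\<exists>M. summable M \<and> (\<forall>n x. norm (t k n x) \<le> M n)" for k
  proof -
    obtain K where K: "\<And>x. \<bar>B k x\<bar> \<le> K" using bound by blast
    have "norm (t k n x) \<le> (1/2)^n * fact k * K" for n x
      unfolding t_def real_norm_def abs_mult
      using K[of 0] u[of n] power_times_exp_minus_le_fact[OF u[of n], of k]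
      by (intro mult_mono K mult_nonneg_nonneg) (auto simp: abs_mult)
    moreover have "summable (\<lambda>n. (1/2)^n * fact k * K)"
      by (intro summable_mult2 summable_geometric) auto
    ultimately show ?thesis by blast
  qed
  have t_deriv: "(t k n has_real_derivative t (Suc k) n x) (at x)" for k n x
  proof -
    have "((\<lambda>x. B k (u n * (x - q n))) has_real_derivative B (Suc k) (u n * (x - q n)) * u n) (at x)"
      by (rule DERIV_chain2[OF deriv]) (auto intro!: derivative_eq_intros)
    then have "((\<lambda>x. (1/2)^n * (u n ^ k * exp (- u n)) * B k (u n * (x - q n)))
        has_real_derivative (1/2)^n * (u n ^ k * exp (- u n)) * (B (Suc k) (u n * (x - q n)) * u n)) (at x)"
      by (rule DERIV_cmult)
    then show ?thesis by (simp add: t_def[abs_def] mult_ac)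
  qed
  have "((\<lambda>x. \<Sum>n. t k n x) has_real_derivative (\<Sum>n. t (Suc k) n x)) (at x)" for k x
  proof (rule has_field_derivative_series'(2)[of UNIV _ _ 0])
    show "(t k n has_real_derivative t (Suc k) n y) (at y within UNIV)" for n y
      by (rule t_deriv)
    show "uniformly_convergent_on UNIV (\<lambda>n x. \<Sum>i<n. t (Suc k) i x)"
    proof -
      obtain M where "summable M" "\<And>n x. norm (t (Suc k) n x) \<le> M n"
        using t_bound by blast
      then show ?thesis by (intro Weierstrass_m_test')
    qed
    show "summable (\<lambda>n. t k n 0)"
    proof -
      obtain M where M: "summable M" "\<And>n x. norm (t k n x) \<le> M n"
        using t_bound by blast
      show ?thesis by (rule summable_comparison_test'[OF M(1), of 0]) (rule M(2))
    qed
  qed auto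
  then show ?thesis
    unfolding has_derivatives_of_all_orders_on_def
    by (intro exI[of _ "\<lambda>k x. \<Sum>n. t k n x"])
       (auto simp: t_def intro: has_field_derivative_at_within)
qed

section \<open>Disjoint small balls that absorb a sequence\<close>

text \<open>
  The radii are chosen recursively. If \<open>q n\<close> lies in an earlier ball of positive radius, then
  \<open>r n = 0\<close> marks that no ball is placed there. Otherwise \<open>q n\<close> has positive distance to each of the
  finitely many earlier balls, and every sufficiently small positive radius will do.
\<close>
lemma disjoint_cballs_absorbing_sequence:
  fixes q :: "nat \<Rightarrow> 'a :: metric_space" and e :: "nat \<Rightarrow> real"
  assumes e: "\<And>n. 0 < e n"
  shows "\<exists>r. (\<forall>n. 0 \<le> r n \<and> r n \<le> e n) \<and>
       (\<forall>m n. m \<noteq> n \<and> 0 < r m \<and> 0 < r n \<longrightarrow> r m + r n < dist (q m) (q n)) \<and>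
       (\<forall>n. \<exists>m. 0 < r m \<and> dist (q n) (q m) \<le> r m)"
proof -
  define P where "P f n x \<longleftrightarrow> 0 \<le> x \<and> x \<le> e n \<and>
      (\<forall>m<n. 0 < f m \<and> 0 < x \<longrightarrow> f m + x < dist (q m) (q n)) \<and>
      (0 < x \<or> (\<exists>m<n. 0 < f m \<and> dist (q n) (q m) \<le> f m))" for f :: "nat \<Rightarrow> real" and n x
  have "\<exists>r. \<forall>n. P r n (r n)"
  proof (rule dependent_wellorder_choice)
    show "P f n x = P g n x" if "\<And>m. m < n \<Longrightarrow> f m = g m" for x f g n
      using that by (auto simp: P_def)
    fix n and f :: "nat \<Rightarrow> real"
    show "\<exists>x. P f n x"
    proof (cases "\<exists>m<n. 0 < f m \<and> dist (q n) (q m) \<le> f m")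
      case True
      then have "P f n 0" using e[of n] by (auto simp: P_def less_imp_le)
      then show ?thesis ..
    next
      case False
      have "\<forall>\<^sub>F x in at_right 0. \<forall>m\<in>{m. m < n \<and> 0 < f m}. x < dist (q m) (q n) - f m"
        using False
        by (intro eventually_ball_finite ballI order_tendstoD(2)[OF tendsto_ident_at])
           (auto simp: dist_commute not_le)
      moreover have "\<forall>\<^sub>F x in at_right 0. x \<in> {0<..<e n}"
        using e by (rule eventually_at_right_real)
      ultimately have "\<forall>\<^sub>F x in at_right 0. P f n x"
        by eventually_elim (auto simp: P_def less_diff_eq add.commute)
      then show ?thesis
        using eventually_happens'[OF trivial_limit_at_right_real] by blast
    qed
  qed
  then obtain r where r: "\<And>n. P r n (r n)" by blast
  show ?thesis
  proof (intro exI[of _ r] conjI allI impI)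
    show "r m + r n < dist (q m) (q n)" if "m \<noteq> n \<and> 0 < r m \<and> 0 < r n" for m n
      using that r[of m] r[of n] unfolding P_def
      by (metis add.commute dist_commute nat_neq_iff)
    show "\<exists>m. 0 < r m \<and> dist (q n) (q m) \<le> r m" for n
      using r[of n] by (auto simp: P_def intro: exI[of _ n])
    show "0 \<le> r n" "r n \<le> e n" for n
      using r[of n] by (simp_all add: P_def)
  qed
qed

text \<open>
  Only finitely many balls have radius at least \<open>d / 4\<close>, and they stay at positive distance from
  the uncovered point \<open>x\<close>. A term of the sequence that is closer to \<open>x\<close> than this distance and than
  \<open>d / 4\<close> must therefore lie in a ball of radius less than \<open>d / 4\<close>, and this ball cannot leave \<open>ball x d\<close>.
\<close>
lemma small_ball_near_uncovered_point:
  fixes q :: "nat \<Rightarrow> 'a :: metric_space"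
  assumes lim: "r \<longlonglongrightarrow> 0"
    and absorb: "\<And>n. \<exists>m. 0 < r m \<and> dist (q n) (q m) \<le> r m"
    and dense: "\<And>d. 0 < d \<Longrightarrow> \<exists>n. dist x (q n) < d"
    and x: "\<And>n. x \<notin> cball (q n) (r n)"
    and "0 < d"
  shows "\<exists>m. 0 < r m \<and> cball (q m) (r m) \<subseteq> ball x d"
proof -
  obtain N where N: "\<And>n. n \<ge> N \<Longrightarrow> r n < d/4"
    using order_tendstoD(2)[OF lim, of "d/4"] \<open>0 < d\<close> by (auto simp: eventually_sequentially)
  have "\<forall>\<^sub>F t in at_right 0. \<forall>n\<in>{..<N}. t < dist x (q n) - r n"
    using x
    by (intro eventually_ball_finite ballI order_tendstoD(2)[OF tendsto_ident_at])
       (auto simp: dist_commute not_le)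
  moreover have "\<forall>\<^sub>F t in at_right 0. t \<in> {0<..<d/4}"
    using \<open>0 < d\<close> by (intro eventually_at_right_real) auto
  ultimately have "\<forall>\<^sub>F t in at_right 0. 0 < t \<and> t < d/4 \<and> (\<forall>n<N. t < dist x (q n) - r n)"
    by eventually_elim auto
  then obtain t where t: "0 < t" "t < d/4" "\<And>n. n < N \<Longrightarrow> t < dist x (q n) - r n"
    using eventually_happens'[OF trivial_limit_at_right_real] by blast
  obtain n where n: "dist x (q n) < t" using dense t(1) by blast
  obtain m where m: "0 < r m" "dist (q n) (q m) \<le> r m" using absorb by blast
  have xm: "dist x (q m) < t + r m"
    using n m(2) dist_triangle[of x "q m" "q n"] by linarith
  then have "r m < d/4" using t(3)[of m] N[of m] by (cases "m < N") auto
  have "cball (q m) (r m) \<subseteq> ball x d"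
  proof
    fix y assume "y \<in> cball (q m) (r m)"
    then show "y \<in> ball x d"
      using dist_triangle[of x y "q m"] xm \<open>r m < d/4\<close> t by auto
  qed
  with m show ?thesis by blast
qed

section \<open>The function and the set\<close>

theorem theorem2:
  "\<exists>(f :: real \<Rightarrow> real) (E :: real set).
     has_derivatives_of_all_orders_on f {0..1} \<and>
     E \<in> sets lebesgue \<and> E \<subseteq> {0..1} \<and> emeasure lebesgue E > 0 \<and>
     (\<forall>x\<in>E. cuts_real_axis_at f x)"
proof -
  obtain B :: "nat \<Rightarrow> real \<Rightarrow> real"
    where B_deriv: "\<And>k x. (B k has_real_derivative B (Suc k) x) (at x)"
      and B_bound: "\<And>k. \<exists>K. \<forall>x. \<bar>B k x\<bar> \<le> K"
      and B_zero: "\<And>x. 1 \<le> \<bar>x\<bar> \<Longrightarrow> B 0 x = 0" "B 0 0 = 0"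
      and B_sign: "B 0 (1/2) > 0" "B 0 (-1/2) < 0"
    using odd_bump_exists by blast
  define q where "q = (from_nat_into \<rat> :: nat \<Rightarrow> real)"
  have q_range: "range q = \<rat>"
    unfolding q_def using countable_rat Rats_0 by (intro range_from_nat_into) auto
  have q_dense: "\<exists>n. dist x (q n) < d" if d: "0 < d" for x d
  proof -
    obtain y where "y \<in> \<rat>" "x < y" "y < x + d"
      using Rats_dense_in_real[of x "x + d"] d by auto
    moreover obtain n where "q n = y" using q_range \<open>y \<in> \<rat>\<close> by (metis rangeE)
    ultimately show ?thesis by (intro exI[of _ n]) (simp add: dist_real_def)
  qed
  \<comment> \<open>The intervals have length at most \<open>2 * e n\<close>, and these lengths add up to \<open>1/2\<close>.\<close>
  define e where "e n = (1/8) * (1/2 :: real)^n" for n :: nat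
  have e_pos: "0 < e n" for n by (simp add: e_def)
  obtain r where r_bounds: "\<forall>n. 0 \<le> r n \<and> r n \<le> e n"
    and r_disjoint: "\<forall>m n. m \<noteq> n \<and> 0 < r m \<and> 0 < r n \<longrightarrow> r m + r n < dist (q m) (q n)"
    and r_absorb: "\<forall>n. \<exists>m. 0 < r m \<and> dist (q n) (q m) \<le> r m"
    using disjoint_cballs_absorbing_sequence[of e q, OF e_pos] by (elim exE conjE)
  have r0: "0 \<le> r n" and r_le: "r n \<le> (1/8) * (1/2)^n" for n
    using r_bounds by (auto simp: e_def)
  have r_lim: "r \<longlonglongrightarrow> 0"
  proof (rule tendsto_sandwich[of "\<lambda>_. 0"])
    show "(\<lambda>n. (1/8) * (1/2)^n :: real) \<longlonglongrightarrow> 0"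
      by (intro tendsto_mult_right_zero LIMSEQ_realpow_zero) auto
  qed (use r0 r_le in auto)

  \<comment> \<open>For \<open>r n = 0\<close> the convention \<open>inverse 0 = 0\<close> turns the piece into a multiple of \<open>B 0 0 = 0\<close>.\<close>
  define piece where "piece n x = (1/2)^n * exp (- inverse (r n)) * B 0 (inverse (r n) * (x - q n))" for n x
  define f where "f x = (\<Sum>n. piece n x)" for x
  define U where "U = (\<Union>n. cball (q n) (r n))"
  \<comment> \<open>Removing the endpoints \<open>0\<close> and \<open>1\<close> ensures that nearby intervals lie inside \<open>{0..1}\<close>.\<close>
  define E where "E = {0<..<1} - U"

  have smooth: "has_derivatives_of_all_orders_on f {0..1}"
    unfolding f_def piece_def
    by (intro rescaled_series_has_derivatives_of_all_orders B_deriv B_bound) (simp add: r0)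

  have piece_zero: "piece n x = 0" if "r n = 0 \<or> r n \<le> \<bar>x - q n\<bar>" for n x
  proof (cases "r n = 0")
    case False
    then have "1 \<le> \<bar>inverse (r n) * (x - q n)\<bar>"
      using that r0[of n] by (simp add: abs_mult field_simps)
    then show ?thesis by (simp add: piece_def B_zero)
  qed (simp add: piece_def B_zero)
  have f_zero: "f x = 0" if "x \<notin> U" for x
  proof -
    have "piece n x = 0" for n
      using that by (intro piece_zero) (auto simp: U_def dist_real_def abs_minus_commute not_le less_imp_le)
    then show ?thesis by (simp add: f_def)
  qed
  have f_single: "f (q n + h * r n) = (1/2)^n * exp (- inverse (r n)) * B 0 h"
    if n: "0 < r n" and h: "\<bar>h\<bar> \<le> 1" for n h
  proof -
    have hr: "\<bar>h * r n\<bar> \<le> r n" using n h by (simp add: abs_mult mult_left_le_one_le)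
    have "piece m (q n + h * r n) = 0" if "m \<noteq> n" for m
      using r_disjoint[rule_format, of m n] that n r0[of m] hr
      by (intro piece_zero) (cases "r m = 0", auto simp: dist_real_def)
    then have "f (q n + h * r n) = (\<Sum>m\<in>{n}. piece m (q n + h * r n))"
      unfolding f_def by (intro suminf_finite) auto
    also have "\<dots> = (1/2)^n * exp (- inverse (r n)) * B 0 h"
      using n by (simp add: piece_def mult.left_commute[of _ h])
    finally show ?thesis .
  qed

  have cuts: "cuts_real_axis_at f x" if xE: "x \<in> E" for x
    unfolding cuts_real_axis_at_def
  proof (intro conjI allI impI)
    show "x \<in> {0..1}" "f x = 0" using xE f_zero by (auto simp: E_def)
    fix \<delta> :: real assume "0 < \<delta>"
    define d where "d = min \<delta> (min x (1 - x))"
    have "0 < d" using xE \<open>0 < \<delta>\<close> by (auto simp: E_def d_def)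
    then obtain m where m: "0 < r m" "cball (q m) (r m) \<subseteq> ball x d"
      using small_ball_near_uncovered_point[OF r_lim r_absorb[rule_format] q_dense, of x d] xE
      by (auto simp: E_def U_def)
    have in_ball: "q m + h * r m \<in> ball x d" if "\<bar>h\<bar> \<le> 1" for h
      using m that by (intro subsetD[OF m(2)]) (auto simp: dist_real_def abs_mult mult_left_le_one_le)
    have near: "q m + h * r m \<in> {0..1} \<and> \<bar>x - (q m + h * r m)\<bar> < \<delta>" if "\<bar>h\<bar> \<le> 1" for h
      using in_ball[OF that] by (auto simp: dist_real_def d_def)
    show "\<exists>x1\<in>{0..1}. \<exists>x2\<in>{0..1}. \<bar>x - x1\<bar> < \<delta> \<and> \<bar>x - x2\<bar> < \<delta> \<and> f x1 < 0 \<and> 0 < f x2"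
      using near[of "1/2"] near[of "-1/2"] f_single[OF m(1), of "1/2"] f_single[OF m(1), of "-1/2"] B_sign
      by (intro bexI[of _ "q m + (-1/2) * r m"] bexI[of _ "q m + (1/2) * r m"])
         (auto simp: mult_pos_neg)
  qed

  have U_sets: "U \<in> sets lebesgue" unfolding U_def by (intro sets.countable_UN) auto
  then have E_sets: "E \<in> sets lebesgue" unfolding E_def by (intro sets.Diff) auto
  have "emeasure lebesgue U \<le> ennreal (1/2)"
  proof -
    have "emeasure lebesgue U \<le> (\<Sum>n. emeasure lebesgue (cball (q n) (r n)))"
      unfolding U_def by (intro emeasure_subadditive_countably) auto
    also have "\<dots> = (\<Sum>n. ennreal (2 * r n))"
      using r0 by (simp add: cball_eq_atLeastAtMost)
    also have "\<dots> \<le> (\<Sum>n. ennreal (1/4 * (1/2)^n))"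
      using r_le by (intro suminf_le summableI ennreal_leI) (auto simp: mult.commute)
    also have "\<dots> = ennreal (\<Sum>n. 1/4 * (1/2)^n)"
      by (intro suminf_ennreal2 summable_mult summable_geometric) auto
    also have "(\<Sum>n. 1/4 * (1/2)^n) = (1/2 :: real)"
      by (subst suminf_mult) (auto simp: suminf_geometric summable_geometric)
    finally show ?thesis .
  qed
  moreover have "ennreal 1 \<le> emeasure lebesgue E + emeasure lebesgue U"
  proof -
    have "ennreal 1 = emeasure lebesgue {0<..<1::real}" by simp
    also have "\<dots> \<le> emeasure lebesgue (E \<union> U)"
      using E_sets U_sets by (intro emeasure_mono) (auto simp: E_def)
    also have "\<dots> \<le> emeasure lebesgue E + emeasure lebesgue U"
      using E_sets U_sets by (rule emeasure_subadditive)
    finally show ?thesis .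
  qed
  moreover have "\<not> ennreal 1 \<le> ennreal (1/2)" by (subst ennreal_le_iff) auto
  ultimately have "emeasure lebesgue E > 0"
    by (metis add.left_neutral not_gr_zero order_trans)
  with smooth E_sets cuts show ?thesis
    by (intro exI[of _ f] exI[of _ E]) (auto simp: E_def)
qed

end
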